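(* Let $f\in C^{0,1}(\Omega\times\mathbb{R},\mathbb{R})$ be $(\mathrm{DC})$, let $m\in\mathfrak{M}_{\mathrm{inv}}(\Omega,\sigma)$, and let $J\subset\mathbb{R}$ be a compact (nondegenerate) interval. Then: (i) the map $[0,l(J)]\to[0,\infty)$, $\epsilon\mapsto b_{J,\epsilon}(\omega)$ is nondecreasing for all $\omega\in\Omega$. (ii) The map $b_{J,\epsilon}$ is an $\epsilon$-module of d-concavity of $f$ on $J$ whenever $0<\epsilon\le l(J)/2$, and it is $m$-strict for $\epsilon\in[\epsilon_0,l(J)/2]$ if $b_{J,\epsilon_0}$ is $m$-strict. (iii) For $0<\epsilon\le l(J)/2$, the map $\omega\mapsto(1/\epsilon)\int_0^{2\epsilon}b_{J,s}(\omega)\,ds$ is also an $\epsilon$-module of d-concavity of $f$ on $J$, and it takes the value $0$ (at $\omega$) if and only if $b_{J,2\epsilon}(\omega)=0$. (iv) If $0<\epsilon\le l(J)/2$ and $b^\epsilon:\Omega\to\mathbb{R}$ is any other $\epsilon$-module of d-concavity of $f$ on $J$, then $$b^\epsilon(\omega)\le\frac13\left(\frac{l(J)}{\epsilon}\right)^2b_{J,2\epsilon}(\omega)$$ for all $\omega\in\Omega$. In particular, if $b^\epsilon$ is $m$-strict, then $b_{J,2\epsilon}$ is $m$-strict.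
   Context: $\Omega$ is a compact metric space with a continuous flow $\sigma$; $\mathfrak{M}_{\mathrm{inv}}(\Omega,\sigma)$ is the set of normalized $\sigma$-invariant Borel measures on $\Omega$. $C^{0,1}(\Omega\times\mathbb{R},\mathbb{R})$ is the set of functions $f:\Omega\times\mathbb{R}\to\mathbb{R}$ such that $f$ and $f_x$ exist and are jointly continuous. $f$ is $(\mathrm{DC})$ (d-concave) if $f_x(\omega,\cdot)$ is concave on $\mathbb{R}$ for all $\omega\in\Omega$. $l(J)=\sup J-\inf J$. Divided differences: for distinct points, $f(\omega,[a,b])=\frac{f(\omega,b)-f(\omega,a)}{b-a}$ and $f(\omega,[x_1,x_2,x_3])=\frac{f(\omega,[x_2,x_3])-f(\omega,[x_1,x_2])}{x_3-x_1}$. For $0<\epsilon\le l(J)/2$, a continuous function $b^\epsilon:\Omega\to[0,\infty)$ is an $\epsilon$-module of d-concavity of $f$ on $J$ if for every $\omega\in\Omega$ $$f(\omega,[x_1,x_0,x_2])\ge f(\omega,[x_1,x_0,x_3])+b^\epsilon(\omega)$$ whenever $x_0,x_1,x_2,x_3\in J$, $x_0\ne x_i$ for $i\in\{1,2,3\}$, and $x_2-x_1\ge\epsilon$, $x_3-x_2\ge\epsilon$. A continuous $b:\Omega\to[0,\infty)$ is called $m$-strict if $m(\{\omega\in\Omega:b(\omega)>0\})>0$. The standardized $\epsilon$-module of d-concavity of $f$ on $J$, for $\epsilon\in[0,l(J)]$, is $$b_{J,\epsilon}(\omega)=\frac{\epsilon}{4\,l(J)^2}\min_{x\in J_\epsilon}\{2f_x(\omega,x)-f_x(\omega,x-\epsilon/2)-f_x(\omega,x+\epsilon/2)\},\quad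 J_\epsilon=\{x\in\mathbb{R}:[x-\epsilon/2,x+\epsilon/2]\subseteq J\}.$$ *)

theory Defs
  imports "HOL-Probability.Probability"
begin

definition continuous_flow :: "(real \<Rightarrow> 'w::topological_space \<Rightarrow> 'w) \<Rightarrow> bool" where
  "continuous_flow \<sigma> \<longleftrightarrow>
     continuous_on UNIV (\<lambda>(t, \<omega>). \<sigma> t \<omega>) \<and>
     (\<forall>\<omega>. \<sigma> 0 \<omega> = \<omega>) \<and>
     (\<forall>s t \<omega>. \<sigma> (s + t) \<omega> = \<sigma> s (\<sigma> t \<omega>))"

definition invariant_measures :: "(real \<Rightarrow> 'w::topological_space \<Rightarrow> 'w) \<Rightarrow> 'w measure set" where
  "invariant_measures \<sigma> =
     {m. sets m = sets borel \<and> prob_space m \<and>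
         (\<forall>t. \<forall>A\<in>sets borel. emeasure m (\<sigma> t -` A) = emeasure m A)}"

text \<open>In what follows the partial derivative \<open>f\<^sub>x(\<omega>, x)\<close> is written \<open>deriv (f \<omega>) x\<close>.\<close>

definition C01 :: "('w::topological_space \<Rightarrow> real \<Rightarrow> real) \<Rightarrow> bool" where
  "C01 f \<longleftrightarrow>
     continuous_on UNIV (\<lambda>(\<omega>, x). f \<omega> x) \<and>
     (\<forall>\<omega> x. f \<omega> differentiable (at x)) \<and>
     continuous_on UNIV (\<lambda>(\<omega>, x). deriv (f \<omega>) x)"

definition d_concave :: "('w \<Rightarrow> real \<Rightarrow> real) \<Rightarrow> bool" where
  "d_concave f \<longleftrightarrow> (\<forall>\<omega>. concave_on UNIV (deriv (f \<omega>)))"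

definition len :: "real set \<Rightarrow> real" where
  "len J = Sup J - Inf J"

text \<open>Divided differences; meaningful only for pairwise distinct nodes.\<close>

definition divdiff2 :: "(real \<Rightarrow> real) \<Rightarrow> real \<Rightarrow> real \<Rightarrow> real" where
  "divdiff2 g a b = (g b - g a) / (b - a)"

definition divdiff3 :: "(real \<Rightarrow> real) \<Rightarrow> real \<Rightarrow> real \<Rightarrow> real \<Rightarrow> real" where
  "divdiff3 g x1 x2 x3 = (divdiff2 g x2 x3 - divdiff2 g x1 x2) / (x3 - x1)"

definition d_concavity_module ::
    "('w::topological_space \<Rightarrow> real \<Rightarrow> real) \<Rightarrow> real set \<Rightarrow> real \<Rightarrow> ('w \<Rightarrow> real) \<Rightarrow> bool" where
  "d_concavity_module f J \<epsilon> b \<longleftrightarrow>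
     0 < \<epsilon> \<and> \<epsilon> \<le> len J / 2 \<and>
     continuous_on UNIV b \<and> (\<forall>\<omega>. 0 \<le> b \<omega>) \<and>
     (\<forall>\<omega>. \<forall>x0\<in>J. \<forall>x1\<in>J. \<forall>x2\<in>J. \<forall>x3\<in>J.
        x0 \<noteq> x1 \<and> x0 \<noteq> x2 \<and> x0 \<noteq> x3 \<and> x2 - x1 \<ge> \<epsilon> \<and> x3 - x2 \<ge> \<epsilon> \<longrightarrow>
        divdiff3 (f \<omega>) x1 x0 x2 \<ge> divdiff3 (f \<omega>) x1 x0 x3 + b \<omega>)"

definition m_strict :: "'w::topological_space measure \<Rightarrow> ('w \<Rightarrow> real) \<Rightarrow> bool" where
  "m_strict m b \<longleftrightarrow>
     continuous_on UNIV b \<and> (\<forall>\<omega>. 0 \<le> b \<omega>) \<and> measure m {\<omega>. b \<omega> > 0} > 0"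

definition shrunk :: "real set \<Rightarrow> real \<Rightarrow> real set" where
  "shrunk J \<epsilon> = {x. {x - \<epsilon> / 2 .. x + \<epsilon> / 2} \<subseteq> J}"

text \<open>The infimum below is a minimum for \<open>f\<close> of class \<open>C01\<close>, \<open>J\<close> a compact interval and
  \<open>0 \<le> \<epsilon> \<le> len J\<close>; see \<open>std_module_attained\<close>.\<close>

definition std_module :: "('w \<Rightarrow> real \<Rightarrow> real) \<Rightarrow> real set \<Rightarrow> real \<Rightarrow> 'w \<Rightarrow> real" where
  "std_module f J \<epsilon> \<omega> =
     \<epsilon> / (4 * (len J)\<^sup>2) *
     (INF x\<in>shrunk J \<epsilon>.
        2 * deriv (f \<omega>) x - deriv (f \<omega>) (x - \<epsilon> / 2) - deriv (f \<omega>) (x + \<epsilon> / 2))"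

lemma shrunk_Icc:
  assumes "0 \<le> \<epsilon>"
  shows "shrunk {a..b} \<epsilon> = {a + \<epsilon> / 2 .. b - \<epsilon> / 2}"
  using assms by (auto simp: shrunk_def)

lemma std_module_attained:
  fixes f :: "'w::topological_space \<Rightarrow> real \<Rightarrow> real" and a b \<epsilon> :: real
  defines "J \<equiv> {a..b}"
  defines "D \<equiv> \<lambda>\<omega> x. 2 * deriv (f \<omega>) x - deriv (f \<omega>) (x - \<epsilon> / 2) - deriv (f \<omega>) (x + \<epsilon> / 2)"
  assumes "a < b" "C01 f" "0 \<le> \<epsilon>" "\<epsilon> \<le> len J"
  shows "\<exists>x\<in>shrunk J \<epsilon>. (\<forall>y\<in>shrunk J \<epsilon>. D \<omega> x \<le> D \<omega> y) \<and>
           std_module f J \<epsilon> \<omega> = \<epsilon> / (4 * (len J)\<^sup>2) * D \<omega> x"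
proof -
  have S: "shrunk J \<epsilon> = {a + \<epsilon> / 2 .. b - \<epsilon> / 2}"
    using shrunk_Icc assms(5) by (simp add: J_def)
  have ne: "shrunk J \<epsilon> \<noteq> {}"
    using assms(3,6) unfolding S by (simp add: len_def J_def)
  have "continuous_on UNIV ((\<lambda>(\<omega>, x). deriv (f \<omega>) x) \<circ> (\<lambda>x. (\<omega>, x)))"
    using assms(4) unfolding C01_def
    by (intro continuous_on_compose continuous_intros) (auto elim: continuous_on_subset)
  then have c: "continuous_on UNIV (deriv (f \<omega>))"
    by (simp add: o_def)
  have "continuous_on (shrunk J \<epsilon>) (D \<omega>)"
    unfolding D_def by (intro continuous_intros continuous_on_compose2[OF c]) auto
  then obtain x where x: "x \<in> shrunk J \<epsilon>" "\<forall>y\<in>shrunk J \<epsilon>. D \<omega> x \<le> D \<omega> y"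
    using continuous_attains_inf[of "shrunk J \<epsilon>" "D \<omega>"] ne by (auto simp: S)
  then have "(INF y\<in>shrunk J \<epsilon>. D \<omega> y) = D \<omega> x"
    by (intro cInf_eq_minimum) auto
  with x show ?thesis
    by (auto simp: std_module_def D_def)
qed

end

theory Submission
  imports Defs
begin

text \<open>
  Fix \<open>\<omega>\<close> and write \<open>h = f\<^sub>x(\<omega>, \<cdot>)\<close>, a concave function, and
  \<open>gap h u x = 2 h(x) - h(x - u) - h(x + u)\<close>. Up to the factor \<open>\<epsilon> / (4 l(J)\<^sup>2)\<close> the
  standardized module is the minimum over \<open>x\<close> of \<open>gap h (\<epsilon>/2) x\<close>.

  Monotonicity in \<open>\<epsilon>\<close> holds because concavity makes the gap nonnegative and nondecreasing in
  \<open>u\<close>, while the set of admissible \<open>x\<close> shrinks.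

  For the module inequality the averaged function of part (iii) comes first; it dominates
  \<open>b\<^bsub>J,\<epsilon>\<^esub>\<close> because the integrand is nondecreasing, so part (ii) follows. The point is that
  \<open>f(\<omega>, [x\<^sub>0, y])\<close> is the average over \<open>t \<in> [0, 1]\<close> of \<open>H\<^sub>t(y) = h(x\<^sub>0 + t (y - x\<^sub>0))\<close>, so
  both third-order divided differences are averages of slopes of the concave functions \<open>H\<^sub>t\<close>. For
  one \<open>t\<close> the drop in slope is at least \<open>gap H\<^sub>t \<epsilon> x\<^sub>2 / l(J)\<close>
  (\<open>concave_nested_slopes\<close>), and this gap is a gap of \<open>h\<close> with step \<open>t \<epsilon>\<close>, hence
  controls \<open>b\<^bsub>J,2t\<epsilon>\<^esub>\<close>. Integrating over \<open>t\<close> and substituting \<open>s = 2 t \<epsilon>\<close> gives the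
  integral of part (iii).

  The zero set of that integral is found from continuity of \<open>s \<mapsto> b\<^bsub>J,s\<^esub>(\<omega>)\<close>; it
  is a special case of joint continuity in \<open>(\<omega>, s)\<close>, which also gives continuity of the modules
  in \<open>\<omega>\<close>.

  For the upper bound on an arbitrary module take \<open>x \<mp> \<epsilon>\<close> and \<open>x\<close> as the nodes and let
  \<open>x\<^sub>0\<close> tend to each of these three points in turn. The three limiting inequalities add up to
  \<open>6 \<epsilon> b\<^sup>\<epsilon>(\<omega>) \<le> gap h \<epsilon> x\<close> (\<open>module_le_gap\<close>), since all difference quotients of
  \<open>f\<close> cancel. This is where the constant \<open>1/3\<close> comes from; the limit \<open>x\<^sub>0 \<rightarrow> x\<close> alone would
  only give \<open>1/2\<close>.
\<close>

section \<open>Second differences of concave functions\<close>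

definition gap :: "(real \<Rightarrow> real) \<Rightarrow> real \<Rightarrow> real \<Rightarrow> real" where
  "gap h u x = 2 * h x - h (x - u) - h (x + u)"

lemma concave_segment:
  assumes "concave_on UNIV h" "0 \<le> t" "t \<le> 1"
  shows "(1 - t) * h x + t * h y \<le> h (x + t * (y - x :: real))"
  using concave_onD[OF assms, of x y] by (simp add: algebra_simps)

text \<open>As a function of \<open>u\<close>, \<open>gap h u x\<close> is convex and vanishes at \<open>u = 0\<close>.\<close>

lemma gap_scale:
  assumes "concave_on UNIV h" "0 \<le> t" "t \<le> 1"
  shows "gap h (t * v) x \<le> t * gap h v x"
  using concave_segment[OF assms, of x "x + v"] concave_segment[OF assms, of x "x - v"]
  by (simp add: gap_def algebra_simps)

lemma gap_nonneg:
  assumes "concave_on UNIV h"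
  shows "0 \<le> gap h u x"
  using concave_segment[OF assms, of "1/2" "x - u" "x + u"] by (simp add: gap_def)

lemma gap_mono:
  assumes "concave_on UNIV h" "0 \<le> u" "u \<le> v"
  shows "gap h u x \<le> gap h v x"
proof (cases "v = 0")
  case True
  then show ?thesis using assms by simp
next
  case False
  then have t: "0 \<le> u / v" "u / v \<le> 1" "u / v * v = u"
    using assms by auto
  then have "gap h u x \<le> u / v * gap h v x"
    using gap_scale[OF assms(1) t(1,2), of v x] by simp
  also have "\<dots> \<le> gap h v x"
    using gap_nonneg[OF assms(1)] t(1,2) by (rule mult_left_le_one_le)
  finally show ?thesis .
qed

text \<open>Slopes of a concave function decrease, so replacing the outer nodes by \<open>y2 - s\<close> and
  \<open>y2 + s\<close>, which lie closer to \<open>y2\<close>, can only decrease the left slope and increase the right one.\<close>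

lemma concave_slope_drop:
  assumes "concave_on UNIV h" "0 < s" "s \<le> y2 - y1" "s \<le> y3 - y2"
  shows "gap h s y2 / s \<le> (h y2 - h y1) / (y2 - y1) - (h y3 - h y2) / (y3 - y2)"
proof -
  \<comment> \<open>Both sides at once: the direction \<open>\<rho>\<close> is \<open>1\<close> towards \<open>y3\<close> and \<open>-1\<close> towards \<open>y1\<close>.\<close>
  have shrink: "(h z - h y2) / r \<le> (h (y2 + s * \<rho>) - h y2) / s"
    if "s \<le> r" "z = y2 + r * \<rho>" for r z \<rho>
  proof -
    have "(1 - s / r) * h y2 + s / r * h z \<le> h (y2 + s / r * (z - y2))"
      using that assms(2) by (intro concave_segment assms) auto
    moreover have "s / r * (z - y2) = s * \<rho>"
      using that assms(2) by simp
    ultimately have "s / r * (h z - h y2) \<le> h (y2 + s * \<rho>) - h y2"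
      by (simp add: algebra_simps)
    then show ?thesis
      using assms(2) by (simp add: field_simps)
  qed
  have "(h y1 - h y2) / (y2 - y1) \<le> (h (y2 - s) - h y2) / s"
    using shrink[of "y2 - y1" y1 "-1"] assms by simp
  moreover have "(h y3 - h y2) / (y3 - y2) \<le> (h (y2 + s) - h y2) / s"
    using shrink[of "y3 - y2" y3 1] assms by simp
  moreover have "(h y1 - h y2) / (y2 - y1) = - ((h y2 - h y1) / (y2 - y1))"
    by (simp add: minus_divide_left)
  moreover have "gap h s y2 / s = - ((h (y2 - s) - h y2) / s) - (h (y2 + s) - h y2) / s"
    by (simp add: gap_def add_divide_distrib diff_divide_distrib)
  ultimately show ?thesis by linarith
qed

text \<open>The slope over \<open>[y1, y3]\<close> is the mean of the slopes over the two subintervals, weighted by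
  their lengths, and the weight of the right one is at least \<open>s / L\<close>.\<close>

lemma concave_nested_slopes:
  assumes "concave_on UNIV h" "0 < s" "s \<le> y2 - y1" "s \<le> y3 - y2" "y3 - y1 \<le> L"
  shows "gap h s y2 / L \<le> (h y2 - h y1) / (y2 - y1) - (h y3 - h y1) / (y3 - y1)"
proof -
  let ?d = "(h y2 - h y1) / (y2 - y1) - (h y3 - h y2) / (y3 - y2)"
  have d: "gap h s y2 / s \<le> ?d"
    using concave_slope_drop assms by blast
  have "gap h s y2 / L = s / L * (gap h s y2 / s)"
    using assms by simp
  also have "\<dots> \<le> (y3 - y2) / (y3 - y1) * ?d"
  proof (rule mult_mono[OF _ d])
    show "s / L \<le> (y3 - y2) / (y3 - y1)"
      using assms by (intro frac_le) auto
  qed (use assms gap_nonneg[OF assms(1), of s y2] in auto)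
  also have "\<dots> = (h y2 - h y1) / (y2 - y1) - (h y3 - h y1) / (y3 - y1)"
  proof -
    have "y2 - y1 \<noteq> 0" "y3 - y2 \<noteq> 0" "y3 - y1 \<noteq> 0" using assms by auto
    then show ?thesis
      by (simp add: divide_simps) (simp add: algebra_simps)
  qed
  finally show ?thesis .
qed

section \<open>Minima depending on a parameter\<close>

lemma continuous_on_sections:
  assumes "continuous_on (A \<times> B) (\<lambda>(x, y). F x y)"
  shows "x \<in> A \<Longrightarrow> continuous_on B (\<lambda>y. F x y)"
    and "y \<in> B \<Longrightarrow> continuous_on A (\<lambda>x. F x y)"
proof -
  have "continuous_on B (\<lambda>y. (x, y))" "continuous_on A (\<lambda>x. (x, y))"
    by (intro continuous_intros)+
  from this[THEN continuous_on_compose2[OF assms]]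
  show "x \<in> A \<Longrightarrow> continuous_on B (\<lambda>y. F x y)"
    and "y \<in> B \<Longrightarrow> continuous_on A (\<lambda>x. F x y)"
    by auto
qed

text \<open>Uniform continuity of \<open>G\<close> moves all values \<open>G z k\<close> by less than a common amount when \<open>z\<close>
  moves a little, and then the infimum moves by no more than that.\<close>

lemma continuous_on_INF_compact:
  fixes G :: "'a::metric_space \<Rightarrow> 'b::metric_space \<Rightarrow> real"
  assumes "compact Z" "compact K" "K \<noteq> {}"
    and cont: "continuous_on (Z \<times> K) (\<lambda>(z, k). G z k)"
  shows "continuous_on Z (\<lambda>z. INF k\<in>K. G z k)"
proof -
  have bdd: "bdd_below (G z ` K)" if "z \<in> Z" for z
  proof -
    have "continuous_on K (G z)"
      using cont that by (rule continuous_on_sections)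
    then show ?thesis
      using assms(2) by (intro bounded_imp_bdd_below compact_imp_bounded compact_continuous_image)
  qed
  have unif: "uniformly_continuous_on (Z \<times> K) (\<lambda>(z, k). G z k)"
    using assms by (intro compact_uniformly_continuous compact_Times)
  have "uniformly_continuous_on Z (\<lambda>z. INF k\<in>K. G z k)"
    unfolding uniformly_continuous_on_def
  proof (intro allI impI)
    fix e :: real assume "0 < e"
    then obtain d where d: "0 < d"
      "\<And>p q. p \<in> Z \<times> K \<Longrightarrow> q \<in> Z \<times> K \<Longrightarrow> dist q p < d
        \<Longrightarrow> dist (case q of (z, k) \<Rightarrow> G z k) (case p of (z, k) \<Rightarrow> G z k) < e / 2"
      using unif unfolding uniformly_continuous_on_def by (metis half_gt_zero)
    have le: "(INF k\<in>K. G z k) - e / 2 \<le> (INF k\<in>K. G z' k)"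
      if z: "z \<in> Z" "z' \<in> Z" "dist z' z < d" for z z'
    proof (rule cINF_greatest[OF assms(3)])
      fix k assume k: "k \<in> K"
      have "\<bar>G z' k - G z k\<bar> < e / 2"
        using d(2)[of "(z, k)" "(z', k)"] z k by (simp add: dist_Pair_Pair dist_real_def)
      moreover have "(INF k\<in>K. G z k) \<le> G z k"
        using bdd z k by (intro cINF_lower)
      ultimately show "(INF k\<in>K. G z k) - e / 2 \<le> G z' k" by linarith
    qed
    have "dist (INF k\<in>K. G z' k) (INF k\<in>K. G z k) < e"
      if z: "z \<in> Z" "z' \<in> Z" "dist z' z < d" for z z'
      using le[OF z] le[of z' z] z \<open>0 < e\<close> by (simp add: dist_commute dist_real_def)
    then show "\<exists>d>0. \<forall>z\<in>Z. \<forall>z'\<in>Z. dist z' z < d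
        \<longrightarrow> dist (INF k\<in>K. G z' k) (INF k\<in>K. G z k) < e"
      using d(1) by blast
  qed
  then show ?thesis by (rule uniformly_continuous_imp_continuous)
qed

section \<open>The standardized module\<close>

lemma std_module_gap:
  "std_module f J \<epsilon> \<omega> =
     \<epsilon> / (4 * (len J)\<^sup>2) * (INF x\<in>shrunk J \<epsilon>. gap (deriv (f \<omega>)) (\<epsilon> / 2) x)"
  by (simp add: std_module_def gap_def)

lemma len_Icc: "a \<le> b \<Longrightarrow> len {a..b} = b - a"
  by (simp add: len_def)

lemma C01_continuous_deriv:
  assumes "C01 f" "continuous_on S g" "continuous_on S k"
  shows "continuous_on S (\<lambda>z. deriv (f (g z)) (k z))"
proof -
  have "continuous_on UNIV (\<lambda>(\<omega>, x). deriv (f \<omega>) x)"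
    using assms(1) by (simp add: C01_def)
  from continuous_on_compose2[OF this, of S "\<lambda>z. (g z, k z)"] show ?thesis
    using assms by (auto intro!: continuous_intros)
qed

lemma std_module_minimizer:
  assumes "a < b" "C01 f" "0 \<le> \<epsilon>" "\<epsilon> \<le> len {a..b}"
  obtains x where "x \<in> shrunk {a..b} \<epsilon>"
    "std_module f {a..b} \<epsilon> \<omega> = \<epsilon> / (4 * (len {a..b})\<^sup>2) * gap (deriv (f \<omega>)) (\<epsilon> / 2) x"
  using std_module_attained[OF assms, of \<omega>] by (auto simp: gap_def)

lemma std_module_le_gap:
  assumes "a < b" "C01 f" "0 \<le> \<epsilon>" "\<epsilon> \<le> len {a..b}" "x \<in> shrunk {a..b} \<epsilon>"
  shows "std_module f {a..b} \<epsilon> \<omega> \<le> \<epsilon> / (4 * (len {a..b})\<^sup>2) * gap (deriv (f \<omega>)) (\<epsilon> / 2) x"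
  using std_module_attained[OF assms(1-4), of \<omega>] assms(3,5)
  by (auto simp: gap_def intro!: mult_left_mono divide_right_mono)

lemma std_module_nonneg:
  assumes "a < b" "C01 f" "d_concave f" "0 \<le> \<epsilon>" "\<epsilon> \<le> len {a..b}"
  shows "0 \<le> std_module f {a..b} \<epsilon> \<omega>"
proof -
  obtain x where "std_module f {a..b} \<epsilon> \<omega> =
      \<epsilon> / (4 * (len {a..b})\<^sup>2) * gap (deriv (f \<omega>)) (\<epsilon> / 2) x"
    using std_module_minimizer assms by metis
  then show ?thesis
    using assms gap_nonneg by (simp add: d_concave_def)
qed

text \<open>A minimizer for the larger \<open>\<epsilon>'\<close> is admissible for \<open>\<epsilon>\<close>, where its gap is smaller.\<close>

lemma std_module_mono:
  assumes "a < b" "C01 f" "d_concave f" "0 \<le> \<epsilon>" "\<epsilon> \<le> \<epsilon>'" "\<epsilon>' \<le> len {a..b}"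
  shows "std_module f {a..b} \<epsilon> \<omega> \<le> std_module f {a..b} \<epsilon>' \<omega>"
proof -
  have conc: "concave_on UNIV (deriv (f \<omega>))"
    using assms by (simp add: d_concave_def)
  obtain x where x: "x \<in> shrunk {a..b} \<epsilon>'"
    "std_module f {a..b} \<epsilon>' \<omega> = \<epsilon>' / (4 * (len {a..b})\<^sup>2) * gap (deriv (f \<omega>)) (\<epsilon>' / 2) x"
    using std_module_minimizer[of a b f \<epsilon>' \<omega>] assms by auto
  have "x \<in> shrunk {a..b} \<epsilon>"
    using x(1) assms by (auto simp: shrunk_Icc)
  then have "std_module f {a..b} \<epsilon> \<omega>
      \<le> \<epsilon> / (4 * (len {a..b})\<^sup>2) * gap (deriv (f \<omega>)) (\<epsilon> / 2) x"
    using assms by (intro std_module_le_gap) auto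
  also have "\<dots> \<le> \<epsilon>' / (4 * (len {a..b})\<^sup>2) * gap (deriv (f \<omega>)) (\<epsilon>' / 2) x"
    using assms gap_nonneg[OF conc]
    by (intro mult_mono divide_right_mono gap_mono conc) auto
  finally show ?thesis using x by simp
qed

text \<open>Parametrizing the moving interval by \<open>[0, 1]\<close> turns the minimum defining the standardized
  module into one over a fixed compact set.\<close>

lemma shrunk_Icc_image:
  assumes "a < b" "0 \<le> \<epsilon>" "\<epsilon> \<le> b - a"
  shows "shrunk {a..b} \<epsilon> = (\<lambda>t. a + \<epsilon> / 2 + t * (b - a - \<epsilon>)) ` {0..1}"
proof -
  have "shrunk {a..b} \<epsilon> = closed_segment (a + \<epsilon> / 2) (b - \<epsilon> / 2)"
    using assms by (simp add: shrunk_Icc closed_segment_eq_real_ivl field_simps)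
  also have "\<dots> = (\<lambda>t. a + \<epsilon> / 2 + t * (b - a - \<epsilon>)) ` {0..1}"
    unfolding closed_segment_image_interval
    by (intro image_cong refl) (simp add: field_simps)
  finally show ?thesis .
qed

lemma std_module_continuous:
  fixes f :: "'w::metric_space \<Rightarrow> real \<Rightarrow> real"
  assumes "compact (UNIV :: 'w set)" "a < b" "C01 f"
  shows "continuous_on (UNIV \<times> {0..len {a..b}}) (\<lambda>(\<omega>, \<epsilon>). std_module f {a..b} \<epsilon> \<omega>)"
proof -
  let ?Z = "(UNIV :: 'w set) \<times> {0..b - a}"
  define G where "G = (\<lambda>z::'w \<times> real. \<lambda>t.
    gap (deriv (f (fst z))) (snd z / 2) (a + snd z / 2 + t * (b - a - snd z)))"
  have "continuous_on (?Z \<times> {0..1::real}) (\<lambda>(z, t). G z t)"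
    unfolding G_def gap_def case_prod_beta
    by (intro continuous_intros C01_continuous_deriv assms) auto
  then have "continuous_on ?Z (\<lambda>z. INF t\<in>{0..1}. G z t)"
    using assms by (intro continuous_on_INF_compact compact_Times) auto
  then have "continuous_on ?Z (\<lambda>z. snd z / (4 * (b - a)\<^sup>2) * (INF t\<in>{0..1}. G z t))"
    using assms by (intro continuous_intros) auto
  moreover have "snd z / (4 * (b - a)\<^sup>2) * (INF t\<in>{0..1}. G z t)
      = (\<lambda>(\<omega>, \<epsilon>). std_module f {a..b} \<epsilon> \<omega>) z" if "z \<in> ?Z" for z
    using that assms
    by (auto simp: std_module_gap len_Icc shrunk_Icc_image G_def image_image)
  ultimately show ?thesis
    using assms by (simp add: len_Icc cong: continuous_on_cong)
qed

lemma std_module_continuous_point: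
  fixes f :: "'w::metric_space \<Rightarrow> real \<Rightarrow> real"
  assumes "compact (UNIV :: 'w set)" "a < b" "C01 f" "0 \<le> \<epsilon>" "\<epsilon> \<le> len {a..b}"
  shows "continuous_on UNIV (std_module f {a..b} \<epsilon>)"
  using continuous_on_sections(2)[OF std_module_continuous[OF assms(1-3)]] assms(4,5) by simp

lemma std_module_continuous_scale:
  fixes f :: "'w::metric_space \<Rightarrow> real \<Rightarrow> real"
  assumes "compact (UNIV :: 'w set)" "a < b" "C01 f" "c \<le> len {a..b}"
  shows "continuous_on {0..c} (\<lambda>\<epsilon>. std_module f {a..b} \<epsilon> \<omega>)"
  using continuous_on_sections(1)[OF std_module_continuous[OF assms(1-3)], of \<omega>] assms(4)
  by (auto elim: continuous_on_subset)

section \<open>Divided differences as averages of the derivative\<close>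

lemma C01_DERIV:
  assumes "C01 f"
  shows "(f \<omega> has_real_derivative deriv (f \<omega>) x) (at x within S)"
  using assms unfolding C01_def
  by (metis DERIV_deriv_iff_real_differentiable has_field_derivative_at_within)

text \<open>The mean value theorem in integral form.\<close>

lemma divdiff2_has_integral:
  assumes "C01 f" "y \<noteq> x0"
  shows "((\<lambda>t. deriv (f \<omega>) (x0 + t * (y - x0))) has_integral divdiff2 (f \<omega>) x0 y) {0..1}"
proof -
  have "((\<lambda>t. deriv (f \<omega>) (x0 + t * (y - x0))) has_integral
      f \<omega> (x0 + 1 * (y - x0)) / (y - x0) - f \<omega> (x0 + 0 * (y - x0)) / (y - x0)) {0..1}"
  proof (rule fundamental_theorem_of_calculus)
    fix t :: real
    have "((\<lambda>t. f \<omega> (x0 + t * (y - x0)) / (y - x0)) has_real_derivative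
        (deriv (f \<omega>) (x0 + t * (y - x0)) * (y - x0)) / (y - x0)) (at t within {0..1})"
      by (rule DERIV_cdivide, rule DERIV_chain2[OF C01_DERIV[OF assms(1)]])
        (auto intro!: derivative_eq_intros)
    then show "((\<lambda>t. f \<omega> (x0 + t * (y - x0)) / (y - x0)) has_vector_derivative
        deriv (f \<omega>) (x0 + t * (y - x0))) (at t within {0..1})"
      using assms(2) by (simp add: has_real_derivative_iff_has_vector_derivative)
  qed simp
  then show ?thesis by (simp add: divdiff2_def diff_divide_distrib)
qed

lemma divdiff2_commute: "divdiff2 g x y = divdiff2 g y x"
  unfolding divdiff2_def by (metis minus_diff_eq minus_divide_divide)

lemma concave_on_affine:
  assumes "concave_on UNIV h"
  shows "concave_on UNIV (\<lambda>y::real. h (p + t * (y - p) :: real))"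
  unfolding concave_on_iff
proof (intro conjI ballI allI impI)
  fix x y u v :: real assume u: "0 \<le> u" "0 \<le> v" "u + v = 1"
  have *: "p + t * ((u *\<^sub>R x + v *\<^sub>R y) - p)
      = u *\<^sub>R (p + t * (x - p)) + v *\<^sub>R (p + t * (y - p))"
  proof -
    have v: "v = 1 - u" using u by simp
    show ?thesis unfolding v by (simp add: algebra_simps)
  qed
  show "u * h (p + t * (x - p)) + v * h (p + t * (y - p))
      \<le> h (p + t * ((u *\<^sub>R x + v *\<^sub>R y) - p))"
    unfolding * using assms u unfolding concave_on_iff by blast
qed auto

text \<open>Both sides are integrals over \<open>t \<in> [0, 1]\<close>: the left one after substituting
  \<open>s = 2 \<epsilon> t\<close>, the right one because \<open>divdiff3 (f \<omega>) x1 x0 y\<close> is the average over \<open>t\<close> of the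
  slope of \<open>H t\<close> between \<open>x1\<close> and \<open>y\<close>. The integrands are compared pointwise.\<close>

lemma averaged_std_module_le_divdiff3:
  fixes f :: "'w::metric_space \<Rightarrow> real \<Rightarrow> real"
  assumes comp: "compact (UNIV :: 'w set)" and ab: "a < b" and f: "C01 f" "d_concave f"
    and e: "0 < \<epsilon>" "\<epsilon> \<le> len {a..b} / 2"
    and J: "x0 \<in> {a..b}" "x1 \<in> {a..b}" "x2 \<in> {a..b}" "x3 \<in> {a..b}"
    and ne: "x0 \<noteq> x1" "x0 \<noteq> x2" "x0 \<noteq> x3"
    and sep: "\<epsilon> \<le> x2 - x1" "\<epsilon> \<le> x3 - x2"
  shows "(1 / \<epsilon>) * integral {0..2 * \<epsilon>} (\<lambda>s. std_module f {a..b} s \<omega>)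
    \<le> divdiff3 (f \<omega>) x1 x0 x2 - divdiff3 (f \<omega>) x1 x0 x3"
proof -
  define h where "h = deriv (f \<omega>)"
  define L where "L = len {a..b}"
  have L: "L = b - a" "0 < L" using ab by (auto simp: L_def len_Icc)
  have conc: "concave_on UNIV h"
    using f by (simp add: d_concave_def h_def)
  define H where "H t y = h (x0 + t * (y - x0))" for t y
  define \<phi> where "\<phi> t = (H t x2 - H t x1) / (x2 - x1) - (H t x3 - H t x1) / (x3 - x1)" for t
  have int_H: "((\<lambda>t. H t y) has_integral divdiff2 (f \<omega>) x0 y) {0..1}" if "x0 \<noteq> y" for y
    unfolding H_def h_def using that by (intro divdiff2_has_integral f) auto
  have int_\<phi>: "(\<phi> has_integral (divdiff3 (f \<omega>) x1 x0 x2 - divdiff3 (f \<omega>) x1 x0 x3)) {0..1}"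
    unfolding \<phi>_def divdiff3_def divdiff2_commute[of _ x1 x0]
    by (intro has_integral_diff has_integral_divide int_H ne)
  have "(\<lambda>s. std_module f {a..b} s \<omega>) integrable_on {0..2 * \<epsilon>}"
    using e by (intro integrable_continuous_real std_module_continuous_scale comp ab f) auto
  then have "((\<lambda>s. std_module f {a..b} s \<omega>) has_integral
      integral {0..2 * \<epsilon>} (\<lambda>s. std_module f {a..b} s \<omega>)) {0..2 * \<epsilon>}"
    by (rule integrable_integral)
  from has_integral_stretch_real[OF this, of "2 * \<epsilon>"] e(1)
  have "((\<lambda>t. std_module f {a..b} (2 * \<epsilon> * t) \<omega>) has_integral
      (1 / (2 * \<epsilon>)) * integral {0..2 * \<epsilon>} (\<lambda>s. std_module f {a..b} s \<omega>)) {0..1}"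
    by (simp add: image_divide_atLeastAtMost)
  from has_integral_mult_right[OF this, of 2]
  have int_b: "((\<lambda>t. 2 * std_module f {a..b} (2 * \<epsilon> * t) \<omega>) has_integral
      (1 / \<epsilon>) * integral {0..2 * \<epsilon>} (\<lambda>s. std_module f {a..b} s \<omega>)) {0..1}"
    by simp
  show ?thesis
  proof (rule has_integral_le[OF int_b int_\<phi>])
    fix t :: real assume t: "t \<in> {0..1}"
    define z where "z = x0 + t * (x2 - x0)"
    \<comment> \<open>Contracting towards \<open>x0\<close> by the factor \<open>t\<close> keeps the points in \<open>J\<close> and turns step
      \<open>\<epsilon>\<close> into \<open>t \<epsilon>\<close>.\<close>
    have gap_H: "gap (H t) \<epsilon> x2 = gap h (t * \<epsilon>) z"
      by (simp add: gap_def H_def z_def algebra_simps)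
    have in_J: "x0 + t * (y - x0) \<in> {a..b}" if "y \<in> {a..b}" for y
    proof -
      have "(1 - t) *\<^sub>R x0 + t *\<^sub>R y \<in> {a..b}"
        using t that J(1) convexD_alt[OF convex_real_interval(5)[of a b]] by auto
      then show ?thesis by (simp add: algebra_simps)
    qed
    have z_in: "z \<in> shrunk {a..b} (2 * \<epsilon> * t)"
      using in_J[of "x2 - \<epsilon>"] in_J[of "x2 + \<epsilon>"] t e J sep
      by (auto simp: shrunk_Icc z_def algebra_simps)
    have te: "0 \<le> t * \<epsilon>" "t * \<epsilon> \<le> \<epsilon>"
      using t e by (auto intro: mult_left_le_one_le)
    have "2 * \<epsilon> * t = 2 * (t * \<epsilon>)" by simp
    then have te2: "0 \<le> 2 * \<epsilon> * t" "2 * \<epsilon> * t \<le> len {a..b}"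
      using te e by linarith+
    have "2 * std_module f {a..b} (2 * \<epsilon> * t) \<omega>
        \<le> 2 * (2 * \<epsilon> * t / (4 * L\<^sup>2) * gap h (2 * \<epsilon> * t / 2) z)"
      unfolding L_def h_def using te2
      by (intro mult_left_mono std_module_le_gap ab f z_in) auto
    also have "\<dots> = (t * \<epsilon> / L) * (gap h (t * \<epsilon>) z / L)"
      using L by (simp add: power2_eq_square field_simps)
    also have "\<dots> \<le> 1 * (gap h (t * \<epsilon>) z / L)"
    proof (rule mult_right_mono)
      have "t * \<epsilon> \<le> L" using te(2) e L(2) unfolding L_def[symmetric] by linarith
      then show "t * \<epsilon> / L \<le> 1" using L(2) by simp
      show "0 \<le> gap h (t * \<epsilon>) z / L" using gap_nonneg[OF conc] L by simp
    qed
    also have "\<dots> = gap (H t) \<epsilon> x2 / L"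
      by (simp add: gap_H)
    also have "\<dots> \<le> \<phi> t"
      unfolding \<phi>_def
    proof (rule concave_nested_slopes)
      show "concave_on UNIV (H t)"
        unfolding H_def by (rule concave_on_affine[OF conc])
    qed (use e sep J L in auto)
    finally show "2 * std_module f {a..b} (2 * \<epsilon> * t) \<omega> \<le> \<phi> t" .
  qed
qed

lemma d_concavity_module_averaged:
  fixes f :: "'w::metric_space \<Rightarrow> real \<Rightarrow> real"
  assumes "compact (UNIV :: 'w set)" "a < b" "C01 f" "d_concave f"
    and "0 < \<epsilon>" "\<epsilon> \<le> len {a..b} / 2"
  shows "d_concavity_module f {a..b} \<epsilon>
    (\<lambda>\<omega>. (1 / \<epsilon>) * integral {0..2 * \<epsilon>} (\<lambda>s. std_module f {a..b} s \<omega>))"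
  unfolding d_concavity_module_def
proof (intro conjI allI ballI impI)
  have "continuous_on (UNIV \<times> cbox 0 (2 * \<epsilon>)) (\<lambda>(\<omega>, s). std_module f {a..b} s \<omega>)"
    using assms by (intro continuous_on_subset[OF std_module_continuous]) auto
  from integral_continuous_on_param[OF this]
  show "continuous_on UNIV
      (\<lambda>\<omega>. (1 / \<epsilon>) * integral {0..2 * \<epsilon>} (\<lambda>s. std_module f {a..b} s \<omega>))"
    by (intro continuous_intros) simp
  show "0 \<le> (1 / \<epsilon>) * integral {0..2 * \<epsilon>} (\<lambda>s. std_module f {a..b} s \<omega>)" for \<omega>
    using assms
    by (intro mult_nonneg_nonneg integral_nonneg integrable_continuous_real
        std_module_continuous_scale std_module_nonneg) auto
next
  fix \<omega> x0 x1 x2 x3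
  assume "x0 \<in> {a..b}" "x1 \<in> {a..b}" "x2 \<in> {a..b}" "x3 \<in> {a..b}"
    and "x0 \<noteq> x1 \<and> x0 \<noteq> x2 \<and> x0 \<noteq> x3 \<and> x2 - x1 \<ge> \<epsilon> \<and> x3 - x2 \<ge> \<epsilon>"
  then show "divdiff3 (f \<omega>) x1 x0 x2 \<ge> divdiff3 (f \<omega>) x1 x0 x3 +
      (1 / \<epsilon>) * integral {0..2 * \<epsilon>} (\<lambda>s. std_module f {a..b} s \<omega>)"
    using averaged_std_module_le_divdiff3[OF assms, of x0 x1 x2 x3 \<omega>] by simp
qed (use assms in auto)

text \<open>By monotonicity the integral over \<open>[\<epsilon>, 2 \<epsilon>]\<close> alone is at least
  \<open>\<epsilon> b\<^bsub>J,\<epsilon>\<^esub>(\<omega>)\<close>.\<close>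

lemma std_module_le_averaged:
  fixes f :: "'w::metric_space \<Rightarrow> real \<Rightarrow> real"
  assumes "compact (UNIV :: 'w set)" "a < b" "C01 f" "d_concave f"
    and "0 < \<epsilon>" "\<epsilon> \<le> len {a..b} / 2"
  shows "std_module f {a..b} \<epsilon> \<omega>
    \<le> (1 / \<epsilon>) * integral {0..2 * \<epsilon>} (\<lambda>s. std_module f {a..b} s \<omega>)"
proof -
  let ?B = "\<lambda>s. std_module f {a..b} s \<omega>"
  have cont: "continuous_on {0..2 * \<epsilon>} ?B"
    using assms by (intro std_module_continuous_scale) auto
  then have int: "?B integrable_on {0..2 * \<epsilon>}" "?B integrable_on {\<epsilon>..2 * \<epsilon>}"
    using assms by (auto intro!: integrable_continuous_real elim: continuous_on_subset)
  have "\<epsilon> * ?B \<epsilon> = integral {\<epsilon>..2 * \<epsilon>} (\<lambda>_. ?B \<epsilon>)"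
    using assms by simp
  also have "\<dots> \<le> integral {\<epsilon>..2 * \<epsilon>} ?B"
    using assms int by (intro integral_le std_module_mono) auto
  also have "\<dots> \<le> integral {0..2 * \<epsilon>} ?B"
    using assms int std_module_nonneg[OF assms(2-4)] by (intro integral_subset_le) auto
  finally show ?thesis
    using assms by (simp add: field_simps)
qed

lemma d_concavity_module_weaken:
  assumes "d_concavity_module f J \<epsilon> b" "continuous_on UNIV b'" "\<And>\<omega>. 0 \<le> b' \<omega>" "\<And>\<omega>. b' \<omega> \<le> b \<omega>"
  shows "d_concavity_module f J \<epsilon> b'"
  using assms(1-3) unfolding d_concavity_module_def
  by (fastforce intro: order_trans[OF add_left_mono[OF assms(4)]])

text \<open>Continuity in the scale \<open>s\<close> is essential: a nondecreasing function on \<open>[0, 2 \<epsilon>]\<close> could be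
  positive at the endpoint only and then have integral zero.\<close>

lemma averaged_std_module_eq_0_iff:
  fixes f :: "'w::metric_space \<Rightarrow> real \<Rightarrow> real"
  assumes "compact (UNIV :: 'w set)" "a < b" "C01 f" "d_concave f"
    and "0 < \<epsilon>" "\<epsilon> \<le> len {a..b} / 2"
  shows "(1 / \<epsilon>) * integral {0..2 * \<epsilon>} (\<lambda>s. std_module f {a..b} s \<omega>) = 0
    \<longleftrightarrow> std_module f {a..b} (2 * \<epsilon>) \<omega> = 0"
proof -
  let ?B = "\<lambda>s. std_module f {a..b} s \<omega>"
  have nonneg: "0 \<le> ?B s" if "s \<in> {0..2 * \<epsilon>}" for s
    using that assms by (intro std_module_nonneg) auto
  have mono: "?B s \<le> ?B (2 * \<epsilon>)" if "s \<in> {0..2 * \<epsilon>}" for s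
    using that assms by (intro std_module_mono) auto
  have "integral {0..2 * \<epsilon>} ?B = 0 \<longleftrightarrow> (\<forall>s\<in>{0..2 * \<epsilon>}. ?B s = 0)"
    using assms nonneg by (intro integral_eq_0_iff std_module_continuous_scale) auto
  also have "\<dots> \<longleftrightarrow> ?B (2 * \<epsilon>) = 0"
    using nonneg mono assms(5) by (fastforce intro: antisym)
  finally show ?thesis using assms(5) by simp
qed

section \<open>Comparison with an arbitrary module\<close>

lemma divdiff2_tendsto:
  assumes "(g has_real_derivative D) (at p)"
  shows "((\<lambda>x. divdiff2 g x y) \<longlongrightarrow> (if p = y then D else divdiff2 g p y)) (at p within S)"
proof (cases "p = y")
  case True
  have "((\<lambda>x. (g x - g p) / (x - p)) \<longlongrightarrow> D) (at p within S)"
    using assms has_field_derivative_at_within has_field_derivative_iff by blast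
  then show ?thesis
    using True by (simp add: divdiff2_commute[of g _ y]) (simp add: divdiff2_def)
next
  case False
  have "(g \<longlongrightarrow> g p) (at p within S)"
    using DERIV_isCont[OF assms] by (simp add: continuous_at_imp_continuous_at_within
      continuous_within[symmetric])
  then have "((\<lambda>x. divdiff2 g x y) \<longlongrightarrow> divdiff2 g p y) (at p within S)"
    unfolding divdiff2_def using False by (intro tendsto_intros) auto
  then show ?thesis using False by simp
qed

text \<open>The module inequality for the nodes \<open>x - \<epsilon>\<close>, \<open>x\<close>, \<open>x + \<epsilon>\<close>, extended by continuity to
  points \<open>p\<close> that may coincide with a node; there the derivative replaces the difference quotient.\<close>

lemma module_le_limit:
  fixes \<omega>
  assumes f: "C01 f" and mod: "d_concavity_module f {a..b} \<epsilon> \<beta>" and "a < b"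
    and J: "x - \<epsilon> \<in> {a..b}" "x + \<epsilon> \<in> {a..b}" "p \<in> {a..b}"
  defines "q \<equiv> \<lambda>y. if p = y then deriv (f \<omega>) p else divdiff2 (f \<omega>) p y"
  shows "2 * \<epsilon> * \<beta> \<omega> \<le> 2 * q x - q (x - \<epsilon>) - q (x + \<epsilon>)"
proof (rule tendsto_lowerbound)
  let ?F = "at p within {a..b}"
  let ?q = "\<lambda>y x0. divdiff2 (f \<omega>) x0 y"
  have e: "0 < \<epsilon>" using mod by (simp add: d_concavity_module_def)
  have "(?q y \<longlongrightarrow> q y) ?F" for y
    unfolding q_def by (rule divdiff2_tendsto[OF C01_DERIV[OF f]])
  then show "((\<lambda>x0. 2 * ?q x x0 - ?q (x - \<epsilon>) x0 - ?q (x + \<epsilon>) x0)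
      \<longlongrightarrow> 2 * q x - q (x - \<epsilon>) - q (x + \<epsilon>)) ?F"
    by (intro tendsto_intros)
  have ne: "\<forall>\<^sub>F x0 in ?F. x0 \<noteq> y" for y
  proof (cases "p = y")
    case True
    then show ?thesis by (auto simp: eventually_at_filter)
  next
    case False
    then show ?thesis by (intro tendsto_imp_eventually_ne[OF tendsto_ident_at])
  qed
  have "\<forall>\<^sub>F x0 in ?F. x0 \<in> {a..b}"
    by (simp add: eventually_at_filter)
  then show "\<forall>\<^sub>F x0 in ?F. 2 * \<epsilon> * \<beta> \<omega> \<le> 2 * ?q x x0 - ?q (x - \<epsilon>) x0 - ?q (x + \<epsilon>) x0"
    using ne[of x] ne[of "x - \<epsilon>"] ne[of "x + \<epsilon>"]
  proof eventually_elim
    case (elim x0)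
    have "divdiff3 (f \<omega>) (x - \<epsilon>) x0 (x + \<epsilon>) + \<beta> \<omega> \<le> divdiff3 (f \<omega>) (x - \<epsilon>) x0 x"
      using mod elim J(1,2) e unfolding d_concavity_module_def by auto
    then have "(?q (x + \<epsilon>) x0 - ?q (x - \<epsilon>) x0) / (2 * \<epsilon>) + \<beta> \<omega>
        \<le> (?q x x0 - ?q (x - \<epsilon>) x0) / \<epsilon>"
      by (simp add: divdiff3_def divdiff2_commute[of _ "x - \<epsilon>"])
    moreover have "A + 2 * \<epsilon> * c \<le> 2 * B" if "A / (2 * \<epsilon>) + c \<le> B / \<epsilon>" for A B c
      using mult_left_mono[OF that, of "2 * \<epsilon>"] e by (simp add: distrib_left)
    ultimately have "?q (x + \<epsilon>) x0 - ?q (x - \<epsilon>) x0 + 2 * \<epsilon> * \<beta> \<omega> \<le> 2 * (?q x x0 - ?q (x - \<epsilon>) x0)"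
      by blast
    then show ?case by simp
  qed
  show "?F \<noteq> bot"
    using J(3) \<open>a < b\<close> by (simp add: trivial_limit_within islimpt_Icc)
qed

text \<open>With \<open>u\<close> and \<open>v\<close> the difference quotients of \<open>f\<close> to the left and right of \<open>x\<close>, the limits
  at \<open>x\<close>, \<open>x - \<epsilon>\<close> and \<open>x + \<epsilon>\<close> each bound \<open>2 \<epsilon> \<beta>(\<omega>)\<close>; \<open>u\<close> and \<open>v\<close> cancel in their
  sum.\<close>

lemma module_le_gap:
  assumes f: "C01 f" and mod: "d_concavity_module f {a..b} \<epsilon> \<beta>" and "a < b"
    and J: "x - \<epsilon> \<in> {a..b}" "x + \<epsilon> \<in> {a..b}"
  shows "6 * \<epsilon> * \<beta> \<omega> \<le> gap (deriv (f \<omega>)) \<epsilon> x"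
proof -
  let ?g = "f \<omega>" and ?h = "deriv (f \<omega>)"
  have e: "0 < \<epsilon>" using mod by (simp add: d_concavity_module_def)
  have "x \<in> {a..b}" using J e by auto
  define u v where "u = (?g x - ?g (x - \<epsilon>)) / \<epsilon>" and "v = (?g (x + \<epsilon>) - ?g x) / \<epsilon>"
  have dd: "divdiff2 ?g (x - \<epsilon>) x = u" "divdiff2 ?g x (x - \<epsilon>) = u"
    "divdiff2 ?g x (x + \<epsilon>) = v" "divdiff2 ?g (x + \<epsilon>) x = v"
    "divdiff2 ?g (x - \<epsilon>) (x + \<epsilon>) = (u + v) / 2" "divdiff2 ?g (x + \<epsilon>) (x - \<epsilon>) = (u + v) / 2"
    using e by (auto simp: divdiff2_def u_def v_def field_simps)
  note lim = module_le_limit[OF f mod \<open>a < b\<close> J, of _ \<omega>]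
  have "2 * \<epsilon> * \<beta> \<omega> \<le> 2 * ?h x - u - v"
    using lim[OF \<open>x \<in> {a..b}\<close>] e by (simp add: dd)
  moreover have "2 * \<epsilon> * \<beta> \<omega> \<le> 2 * u - ?h (x - \<epsilon>) - (u + v) / 2"
    using lim[OF J(1)] e by (simp add: dd)
  moreover have "2 * \<epsilon> * \<beta> \<omega> \<le> 2 * v - (u + v) / 2 - ?h (x + \<epsilon>)"
    using lim[OF J(2)] e by (simp add: dd)
  ultimately have "3 * (2 * \<epsilon> * \<beta> \<omega>) \<le> gap ?h \<epsilon> x"
    unfolding gap_def by argo
  then show ?thesis by simp
qed

lemma module_le_std_module:
  assumes "C01 f" and mod: "d_concavity_module f {a..b} \<epsilon> \<beta>" and "a < b"
  shows "\<beta> \<omega> \<le> 1 / 3 * (len {a..b} / \<epsilon>)\<^sup>2 * std_module f {a..b} (2 * \<epsilon>) \<omega>"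
proof -
  define L where "L = len {a..b}"
  have e: "0 < \<epsilon>" "\<epsilon> \<le> L / 2" and L: "0 < L"
    using mod \<open>a < b\<close> by (auto simp: d_concavity_module_def L_def len_Icc)
  obtain x where x: "x \<in> shrunk {a..b} (2 * \<epsilon>)"
    "std_module f {a..b} (2 * \<epsilon>) \<omega> = 2 * \<epsilon> / (4 * L\<^sup>2) * gap (deriv (f \<omega>)) \<epsilon> x"
    using std_module_minimizer[of a b f "2 * \<epsilon>" \<omega>] assms e by (auto simp: L_def)
  have "6 * \<epsilon> * \<beta> \<omega> \<le> gap (deriv (f \<omega>)) \<epsilon> x"
    using x(1) e by (intro module_le_gap[OF assms]) (auto simp: shrunk_Icc)
  then have "\<beta> \<omega> \<le> gap (deriv (f \<omega>)) \<epsilon> x / (6 * \<epsilon>)"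
    using e by (simp add: field_simps)
  also have "\<dots> = 1 / 3 * (L / \<epsilon>)\<^sup>2 * std_module f {a..b} (2 * \<epsilon>) \<omega>"
    unfolding x(2) using e L by (simp add: power2_eq_square field_simps)
  finally show ?thesis unfolding L_def .
qed

section \<open>Strictness with respect to a measure\<close>

lemma m_strict_dominated:
  fixes m :: "'w::topological_space measure"
  assumes "finite_measure m" "sets m = sets borel" "m_strict m b"
    and "continuous_on UNIV b'" "\<And>\<omega>. 0 \<le> b' \<omega>" "\<And>\<omega>. 0 < b \<omega> \<Longrightarrow> 0 < b' \<omega>"
  shows "m_strict m b'"
proof -
  interpret finite_measure m by fact
  have "open {\<omega>. 0 < b' \<omega>}"
    using assms(4) by (intro open_Collect_less continuous_intros)
  then have "measure m {\<omega>. 0 < b \<omega>} \<le> measure m {\<omega>. 0 < b' \<omega>}"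
    using assms(2,6) by (intro finite_measure_mono) auto
  then show ?thesis
    using assms by (simp add: m_strict_def)
qed

theorem theorem3p5:
  fixes f :: "'w::metric_space \<Rightarrow> real \<Rightarrow> real"
    and \<sigma> :: "real \<Rightarrow> 'w \<Rightarrow> 'w"
    and m :: "'w measure"
    and J :: "real set" and a1 a2 :: real
  assumes "compact (UNIV :: 'w set)"
    and "continuous_flow \<sigma>"
    and "C01 f" and "d_concave f"
    and "m \<in> invariant_measures \<sigma>"
    and "a1 < a2" and "J = {a1..a2}"
  shows
    "(\<forall>\<omega>. (\<forall>\<epsilon>\<in>{0..len J}. 0 \<le> std_module f J \<epsilon> \<omega>) \<and>
          mono_on {0..len J} (\<lambda>\<epsilon>. std_module f J \<epsilon> \<omega>))
     \<and>
     ((\<forall>\<epsilon>. 0 < \<epsilon> \<and> \<epsilon> \<le> len J / 2 \<longrightarrow> d_concavity_module f J \<epsilon> (std_module f J \<epsilon>)) \<and>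
      (\<forall>\<epsilon>\<^sub>0 \<epsilon>. 0 \<le> \<epsilon>\<^sub>0 \<and> m_strict m (std_module f J \<epsilon>\<^sub>0) \<and> \<epsilon> \<in> {\<epsilon>\<^sub>0..len J / 2} \<longrightarrow>
          m_strict m (std_module f J \<epsilon>)))
     \<and>
     (\<forall>\<epsilon>. 0 < \<epsilon> \<and> \<epsilon> \<le> len J / 2 \<longrightarrow>
        d_concavity_module f J \<epsilon> (\<lambda>\<omega>. (1 / \<epsilon>) * integral {0..2 * \<epsilon>} (\<lambda>s. std_module f J s \<omega>)) \<and>
        (\<forall>\<omega>. (1 / \<epsilon>) * integral {0..2 * \<epsilon>} (\<lambda>s. std_module f J s \<omega>) = 0 \<longleftrightarrow>
             std_module f J (2 * \<epsilon>) \<omega> = 0))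
     \<and>
     (\<forall>\<epsilon> b. 0 < \<epsilon> \<and> \<epsilon> \<le> len J / 2 \<and> d_concavity_module f J \<epsilon> b \<longrightarrow>
        (\<forall>\<omega>. b \<omega> \<le> 1 / 3 * (len J / \<epsilon>)\<^sup>2 * std_module f J (2 * \<epsilon>) \<omega>) \<and>
        (m_strict m b \<longrightarrow> m_strict m (std_module f J (2 * \<epsilon>))))"
proof -
  note C = assms(1) \<open>a1 < a2\<close> \<open>C01 f\<close> and D = \<open>d_concave f\<close>
  have m: "finite_measure m" "sets m = sets borel"
    using assms(5) by (auto simp: invariant_measures_def prob_space_def)
  let ?b = "std_module f {a1..a2}" and ?L = "len {a1..a2}"
  have cont: "continuous_on UNIV (?b \<epsilon>)" and nonneg: "0 \<le> ?b \<epsilon> \<omega>"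
    if "0 \<le> \<epsilon>" "\<epsilon> \<le> ?L" for \<epsilon> \<omega>
    using that C D by (auto intro!: std_module_continuous_point std_module_nonneg)
  have mono: "?b \<epsilon> \<omega> \<le> ?b \<epsilon>' \<omega>" if "0 \<le> \<epsilon>" "\<epsilon> \<le> \<epsilon>'" "\<epsilon>' \<le> ?L" for \<epsilon> \<epsilon>' \<omega>
    using that C D by (intro std_module_mono)
  have part2: "d_concavity_module f {a1..a2} \<epsilon> (?b \<epsilon>)" if "0 < \<epsilon>" "\<epsilon> \<le> ?L / 2" for \<epsilon>
    using that
    by (intro d_concavity_module_weaken[OF d_concavity_module_averaged[OF C D that]]
        cont nonneg std_module_le_averaged C D) auto
  have part2': "m_strict m (?b \<epsilon>)"
    if "0 \<le> \<epsilon>0" "m_strict m (?b \<epsilon>0)" "\<epsilon> \<in> {\<epsilon>0..?L / 2}" for \<epsilon>0 \<epsilon>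
    using that by (intro m_strict_dominated[OF m that(2)] cont nonneg)
      (auto intro: less_le_trans[OF _ mono])
  have bound: "\<beta> \<omega> \<le> 1 / 3 * (?L / \<epsilon>)\<^sup>2 * ?b (2 * \<epsilon>) \<omega>"
    if "d_concavity_module f {a1..a2} \<epsilon> \<beta>" for \<epsilon> \<beta> \<omega>
    using that C by (intro module_le_std_module)
  have part4: "m_strict m (?b (2 * \<epsilon>))"
    if "0 < \<epsilon>" "\<epsilon> \<le> ?L / 2" "d_concavity_module f {a1..a2} \<epsilon> \<beta>" "m_strict m \<beta>" for \<epsilon> \<beta>
  proof (rule m_strict_dominated[OF m that(4)])
    fix \<omega> assume "0 < \<beta> \<omega>"
    then have "0 < 1 / 3 * (?L / \<epsilon>)\<^sup>2 * ?b (2 * \<epsilon>) \<omega>"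
      using bound[OF that(3)] by (rule less_le_trans)
    moreover have "0 \<le> 1 / 3 * (?L / \<epsilon>)\<^sup>2"
      by simp
    ultimately show "0 < ?b (2 * \<epsilon>) \<omega>"
      using zero_less_mult_pos2 nonneg that(1,2) by (smt (verit) mult_nonneg_nonpos)
  qed (use that cont nonneg in auto)
  show ?thesis
    unfolding \<open>J = {a1..a2}\<close>
  proof (intro conjI allI ballI impI)
    show "mono_on {0..?L} (\<lambda>\<epsilon>. ?b \<epsilon> \<omega>)" for \<omega>
      using mono by (auto simp: mono_on_def)
  qed (use part2 part2' part4 nonneg bound d_concavity_module_averaged[OF C D]
         averaged_std_module_eq_0_iff[OF C D] in auto)
qed

end
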